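(* Let $V$ be a finite non-empty set, let $(\Omega,\pi)$ be a probability space, and let $f\in L^2(\Omega^{V},\pi^{\otimes V})$ be real-valued with $\mathrm{Var}(f)>0$. Suppose that there is a subgroup $\Gamma\leq \mathrm{Sym}_V$ acting transitively on $V$ such that $f$ is invariant under the action of $\Gamma$ on $\Omega^V$ by permutation of coordinates. Then for every $U\subseteq V$, $$\mathrm{clue}(f\mid U)\leq \frac{|U|}{|V|}.$$ In particular, sparse reconstruction for transitive functions of iid variables is not possible: if, for each $n$, $f_n\in L^2(\Omega_n^{V_n},\pi_n^{\otimes V_n})$ with $\mathrm{Var}(f_n)>0$ is invariant under some transitive permutation group of the finite set $V_n$, then there is no sequence $U_n\subseteq V_n$ with $\lim_n |U_n|/|V_n|=0$ and $\liminf_n \mathrm{clue}(f_n\mid U_n)>0$.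
   Context: For $U\subseteq V$, $\mathcal F_U$ denotes the $\sigma$-algebra on $\Omega^V$ generated by the coordinates in $U$. For $f\in L^2$ with $\mathrm{Var}(f)>0$, the ($L^2$-)clue is $$\mathrm{clue}(f\mid U):=\frac{\mathrm{Var}(\mathbb E[f\mid\mathcal F_U])}{\mathrm{Var}(f)}.$$ Sparse reconstruction for a sequence of functions $f_n$ on $\Omega_n^{V_n}$ means that there are $U_n\subseteq V_n$ with $|U_n|/|V_n|\to 0$ and $\liminf_n\mathrm{clue}(f_n\mid U_n)>0$. *)

theory Defs
  imports "HOL-Probability.Probability" "HOL-Algebra.Group_Action"
begin

abbreviation iid_space :: "'v set \<Rightarrow> 'a measure \<Rightarrow> ('v \<Rightarrow> 'a) measure" where
  "iid_space V M \<equiv> PiM V (\<lambda>_. M)"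

definition square_integrable :: "'a measure \<Rightarrow> ('a \<Rightarrow> real) \<Rightarrow> bool" where
  "square_integrable M f \<longleftrightarrow> f \<in> borel_measurable M \<and> integrable M (\<lambda>x. (f x)\<^sup>2)"

text \<open>The measure component of \<open>coord_algebra V M U\<close> is irrelevant: it only serves as
  the sub-\<open>\<sigma>\<close>-algebra argument of \<^const>\<open>real_cond_exp\<close>. For \<open>U = {}\<close> it is the trivial
  \<open>\<sigma>\<close>-algebra on the full product space.\<close>

definition coord_algebra :: "'v set \<Rightarrow> 'a measure \<Rightarrow> 'v set \<Rightarrow> ('v \<Rightarrow> 'a) measure" where
  "coord_algebra V M U =
     sigma (space (iid_space V M))
       {(\<lambda>x. x u) -` A \<inter> space (iid_space V M) | u A. u \<in> U \<and> A \<in> sets M}"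

definition clue :: "'v set \<Rightarrow> 'a measure \<Rightarrow> (('v \<Rightarrow> 'a) \<Rightarrow> real) \<Rightarrow> 'v set \<Rightarrow> real" where
  "clue V M f U =
     prob_space.variance (iid_space V M) (real_cond_exp (iid_space V M) (coord_algebra V M U) f)
     / prob_space.variance (iid_space V M) f"

definition transitive_perm_group :: "'v set \<Rightarrow> ('v \<Rightarrow> 'v) set \<Rightarrow> bool" where
  "transitive_perm_group V \<Gamma> \<longleftrightarrow>
     subgroup \<Gamma> (BijGroup V) \<and>
     transitive_action ((BijGroup V)\<lparr>carrier := \<Gamma>\<rparr>) V (\<lambda>\<gamma>. \<gamma>)"

text \<open>The left action \<open>(\<gamma> x)\<^sub>v = x\<^bsub>\<gamma>\<inverse> v\<^esub>\<close> on configurations.\<close>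

definition permute_coords :: "'v set \<Rightarrow> ('v \<Rightarrow> 'v) \<Rightarrow> ('v \<Rightarrow> 'a) \<Rightarrow> ('v \<Rightarrow> 'a)" where
  "permute_coords V \<gamma> x = (\<lambda>v\<in>V. x (inv_into V \<gamma> v))"

text \<open>Elements of \<open>L\<^sup>2\<close> are functions up to null sets, hence invariance holds almost everywhere.\<close>

definition perm_invariant ::
    "'v set \<Rightarrow> 'a measure \<Rightarrow> ('v \<Rightarrow> 'v) set \<Rightarrow> (('v \<Rightarrow> 'a) \<Rightarrow> real) \<Rightarrow> bool" where
  "perm_invariant V M \<Gamma> f \<longleftrightarrow>
     (\<forall>\<gamma>\<in>\<Gamma>. AE x in iid_space V M. f (permute_coords V \<gamma> x) = f x)"

definition sparse_reconstruction ::
    "(nat \<Rightarrow> 'v set) \<Rightarrow> (nat \<Rightarrow> 'a measure) \<Rightarrow> (nat \<Rightarrow> ('v \<Rightarrow> 'a) \<Rightarrow> real) \<Rightarrow> bool" where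
  "sparse_reconstruction V M f \<longleftrightarrow>
     (\<exists>U. (\<forall>n. U n \<subseteq> V n) \<and>
          (\<lambda>n. real (card (U n)) / real (card (V n))) \<longlonglongrightarrow> 0 \<and>
          liminf (\<lambda>n. ereal (clue (V n) (M n) (f n) (U n))) > 0)"

end

theory Submission
  imports Defs
begin

text \<open>Write \<open>E\<^sub>A\<close> for conditioning on the coordinates in \<open>A\<close>. Resampling the coordinates off \<open>A\<close>
  shows \<open>E\<^sub>A E\<^sub>B = E\<^bsub>A \<inter> B\<^esub>\<close>. Put \<open>Q A = \<parallel>E\<^sub>A f\<parallel>\<^sup>2\<close>, so that \<open>Q A - Q {}\<close> is the variance of \<open>E\<^sub>A f\<close>.
  If \<open>A \<subseteq> B\<close>, then \<open>Q B - Q A = \<parallel>E\<^sub>B f - E\<^sub>A f\<parallel>\<^sup>2\<close>, and applying the contraction \<open>E\<^sub>U\<close> gives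
  \<open>Q (U \<inter> B) - Q (U \<inter> A) \<le> Q B - Q A\<close>. Revealing the coordinates one by one, a family \<open>S\<^sub>i\<close> that
  covers every coordinate at most \<open>k\<close> times therefore satisfies
  \<open>\<Sum>\<^sub>i (Q S\<^sub>i - Q {}) \<le> k (Q V - Q {})\<close>. For the translates \<open>\<gamma> U\<close>, all summands agree by invariance
  of \<open>f\<close>, and transitivity gives \<open>k = |\<Gamma>| |U| / |V|\<close>.\<close>

section \<open>Conditioning on coordinates by resampling\<close>

text \<open>Integrating over \<open>y\<close> with \<open>x\<close> fixed will give a pointwise
  version of conditioning on the coordinates in \<open>A\<close>. The restriction to
  \<open>V\<close> makes the result extensional, as the points of the product space are.\<close>

definition resample :: "'v set \<Rightarrow> 'v set \<Rightarrow> ('v \<Rightarrow> 'a) \<Rightarrow> ('v \<Rightarrow> 'a) \<Rightarrow> 'v \<Rightarrow> 'a" where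
  "resample V A x y = (\<lambda>v\<in>V. if v \<in> A then x v else y v)"

locale iid_product =
  fixes V :: "'v set" and M :: "'a measure"
  assumes finite_V: "finite V" and prob_M: "prob_space M"
begin

abbreviation "P \<equiv> iid_space V M"
abbreviation "F \<equiv> coord_algebra V M"

sublocale product_prob_space "\<lambda>_. M" V
  using prob_M by unfold_locales
    (auto simp: prob_space_def finite_measure_def sigma_finite_measure_def prob_space_axioms_def finite_measure_axioms_def)

sublocale PP: pair_prob_space P P
  by unfold_locales

lemma space_F: "space (F A) = space P"
  unfolding coord_algebra_def by (rule space_measure_of) auto

lemma sets_F:
  "sets (F A) = sigma_sets (space P) {(\<lambda>x. x u) -` B \<inter> space P | u B. u \<in> A \<and> B \<in> sets M}"
  unfolding coord_algebra_def by (rule sets_measure_of) auto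

lemma subalgebra_F:
  assumes "A \<subseteq> V"
  shows "subalgebra P (F A)"
proof -
  have "sigma_sets (space P) {(\<lambda>x. x u) -` B \<inter> space P | u B. u \<in> A \<and> B \<in> sets M} \<subseteq> sets P"
    using assms by (intro sets.sigma_sets_subset) (auto intro!: measurable_sets)
  then show ?thesis
    by (simp add: subalgebra_def space_F sets_F)
qed

lemma subalgebra_F_mono:
  assumes "A \<subseteq> B"
  shows "subalgebra (F B) (F A)"
proof -
  have "{(\<lambda>x. x u) -` C \<inter> space P | u C. u \<in> A \<and> C \<in> sets M}
      \<subseteq> {(\<lambda>x. x u) -` C \<inter> space P | u C. u \<in> B \<and> C \<in> sets M}"
    using assms by blast
  then show ?thesis
    by (simp add: subalgebra_def space_F sets_F sigma_sets_mono')
qed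

lemma sigma_finite_subalgebra_F:
  assumes "A \<subseteq> V"
  shows "sigma_finite_subalgebra P (F A)"
  by (intro finite_measure_subalgebra_is_sigma_finite finite_measure_subalgebra.intro
      finite_measure_subalgebra_axioms.intro subalgebra_F assms) unfold_locales

lemma measurable_resample [measurable]:
  "(\<lambda>(x, y). resample V A x y) \<in> measurable (P \<Otimes>\<^sub>M P) P"
  unfolding resample_def split_def by measurable

lemma resample_in_space: "x \<in> space P \<Longrightarrow> y \<in> space P \<Longrightarrow> resample V A x y \<in> space P"
  by (auto simp: resample_def space_PiM PiE_iff)

text \<open>A product measure is determined by its values on boxes. The preimage of a box is a
  product of two boxes: each coordinate is constrained in exactly one factor and free, hence of mass
  1, in the other.\<close>

lemma distr_resample:
  "distr (P \<Otimes>\<^sub>M P) P (\<lambda>(x, y). resample V A x y) = P"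
proof (rule PiM_eqI[OF finite_V])
  fix B assume B: "\<And>i. i \<in> V \<Longrightarrow> B i \<in> sets M"
  define B1 where "B1 i = (if i \<in> A then B i else space M)" for i
  define B2 where "B2 i = (if i \<in> A then space M else B i)" for i
  have sub: "i \<in> V \<Longrightarrow> z \<in> B i \<Longrightarrow> z \<in> space M" for i z
    using B sets.sets_into_space by blast
  have "(\<lambda>(x, y). resample V A x y) -` Pi\<^sub>E V B \<inter> space (P \<Otimes>\<^sub>M P) = Pi\<^sub>E V B1 \<times> Pi\<^sub>E V B2"
  proof (intro equalityI subsetI)
    fix z assume "z \<in> (\<lambda>(x, y). resample V A x y) -` Pi\<^sub>E V B \<inter> space (P \<Otimes>\<^sub>M P)"
    then show "z \<in> Pi\<^sub>E V B1 \<times> Pi\<^sub>E V B2"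
      by (cases z) (auto simp: space_pair_measure space_PiM PiE_iff resample_def B1_def B2_def
          split: if_splits)
  next
    fix z assume "z \<in> Pi\<^sub>E V B1 \<times> Pi\<^sub>E V B2"
    moreover obtain x y where "z = (x, y)"
      by (cases z)
    ultimately have x: "x \<in> extensional V" "\<And>i. i \<in> V \<Longrightarrow> x i \<in> B1 i"
      and y: "y \<in> extensional V" "\<And>i. i \<in> V \<Longrightarrow> y i \<in> B2 i" and z: "z = (x, y)"
      by (auto simp: PiE_iff)
    have "x i \<in> space M" "y i \<in> space M" "(if i \<in> A then x i else y i) \<in> B i" if "i \<in> V" for i
      using x(2)[OF that] y(2)[OF that] sub[OF that]
      by (auto simp: B1_def B2_def split: if_splits)
    then show "z \<in> (\<lambda>(x, y). resample V A x y) -` Pi\<^sub>E V B \<inter> space (P \<Otimes>\<^sub>M P)"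
      using x(1) y(1)
      by (simp add: z space_pair_measure space_PiM resample_def PiE_iff del: if_split)
  qed
  moreover have "Pi\<^sub>E V B \<in> sets P"
    using B finite_V by (intro sets_PiM_I_finite) auto
  ultimately have "emeasure (distr (P \<Otimes>\<^sub>M P) P (\<lambda>(x, y). resample V A x y)) (Pi\<^sub>E V B)
      = emeasure (P \<Otimes>\<^sub>M P) (Pi\<^sub>E V B1 \<times> Pi\<^sub>E V B2)"
    by (simp add: emeasure_distr)
  also have "\<dots> = emeasure P (Pi\<^sub>E V B1) * emeasure P (Pi\<^sub>E V B2)"
    using B finite_V
    by (intro P.emeasure_pair_measure_Times sets_PiM_I_finite) (auto simp: B1_def B2_def)
  also have "\<dots> = (\<Prod>i\<in>V. emeasure M (B1 i)) * (\<Prod>i\<in>V. emeasure M (B2 i))"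
    using B finite_V by (subst (1 2) emeasure_PiM) (auto simp: B1_def B2_def)
  also have "\<dots> = (\<Prod>i\<in>V. emeasure M (B i))"
    unfolding prod.distrib[symmetric]
    by (intro prod.cong) (auto simp: B1_def B2_def prob_space.emeasure_space_1[OF prob_M])
  finally show "emeasure (distr (P \<Otimes>\<^sub>M P) P (\<lambda>(x, y). resample V A x y)) (Pi\<^sub>E V B)
      = (\<Prod>i\<in>V. emeasure M (B i))" .
qed simp

lemma integrable_resample:
  fixes f :: "('v \<Rightarrow> 'a) \<Rightarrow> real"
  assumes "integrable P f"
  shows "integrable (P \<Otimes>\<^sub>M P) (\<lambda>(x, y). f (resample V A x y))"
  using integrable_distr[OF measurable_resample, of A f] assms
  unfolding distr_resample by (simp add: split_def)

text \<open>An explicit version of the conditional expectation given \<open>F A\<close>. Unlike an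
  almost-everywhere class, it lets the coordinates on which it depends be read off
  pointwise.\<close>

definition average_off :: "'v set \<Rightarrow> (('v \<Rightarrow> 'a) \<Rightarrow> real) \<Rightarrow> ('v \<Rightarrow> 'a) \<Rightarrow> real" where
  "average_off A f x = (\<integral>y. f (resample V A x y) \<partial>P)"

lemma borel_measurable_average_off [measurable]:
  assumes [measurable]: "f \<in> borel_measurable P"
  shows "average_off A f \<in> borel_measurable P"
proof -
  have "(\<lambda>(x, y). f (resample V A x y)) \<in> borel_measurable (P \<Otimes>\<^sub>M P)"
    using measurable_compose[OF measurable_resample assms] by (simp add: split_def)
  then show ?thesis
    unfolding average_off_def by (rule P.borel_measurable_lebesgue_integral)
qed

lemma integrable_average_off:
  assumes "integrable P f"
  shows "integrable P (average_off A f)"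
  using PP.integrable_fst'[OF integrable_resample[OF assms]] by (simp add: average_off_def[abs_def])

lemma integral_average_off:
  assumes "integrable P f"
  shows "(\<integral>x. average_off A f x \<partial>P) = (\<integral>x. f x \<partial>P)"
proof -
  have "(\<integral>x. average_off A f x \<partial>P) = (\<integral>z. (case z of (x, y) \<Rightarrow> f (resample V A x y)) \<partial>(P \<Otimes>\<^sub>M P))"
    using PP.integral_fst'[OF integrable_resample[OF assms]] by (simp add: average_off_def)
  also have "\<dots> = (\<integral>x. f x \<partial>distr (P \<Otimes>\<^sub>M P) P (\<lambda>(x, y). resample V A x y))"
    using assms by (subst integral_distr) (auto simp: split_def)
  finally show ?thesis
    by (simp add: distr_resample)
qed

text \<open>Freezing the coordinates off \<open>A\<close> at a fixed point \<open>w\<close> does not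
  change \<open>h\<close>. The freezing map is measurable from \<open>F A\<close> to
  \<open>P\<close>, because each of its coordinates is either a coordinate in \<open>A\<close> or
  constant.\<close>

lemma measurable_F_if_determined:
  fixes h :: "('v \<Rightarrow> 'a) \<Rightarrow> real"
  assumes h: "h \<in> borel_measurable P"
    and det: "\<And>x y. x \<in> space P \<Longrightarrow> y \<in> space P \<Longrightarrow> (\<And>v. v \<in> A \<Longrightarrow> x v = y v) \<Longrightarrow> h x = h y"
    and A: "A \<subseteq> V"
  shows "h \<in> borel_measurable (F A)"
proof -
  obtain w where w: "w \<in> space P"
    using P.not_empty by blast
  have coord: "(\<lambda>x. x v) \<in> measurable (F A) M" if "v \<in> A" for v
  proof (rule measurableI)
    show "x v \<in> space M" if "x \<in> space (F A)" for x
      using that \<open>v \<in> A\<close> A by (auto simp: space_F space_PiM)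
    show "(\<lambda>x. x v) -` B \<inter> space (F A) \<in> sets (F A)" if "B \<in> sets M" for B
      unfolding space_F sets_F using that \<open>v \<in> A\<close> by (intro sigma_sets.Basic) auto
  qed
  have "(\<lambda>x. resample V A x w) \<in> measurable (F A) P"
    unfolding resample_def
  proof (rule measurable_restrict)
    show "(\<lambda>x. if v \<in> A then x v else w v) \<in> measurable (F A) M" if "v \<in> V" for v
    proof (cases "v \<in> A")
      case False
      have "w v \<in> space M"
        using that w by (auto simp: space_PiM)
      with False show ?thesis
        by simp
    qed (simp add: coord)
  qed
  then have "(\<lambda>x. h (resample V A x w)) \<in> borel_measurable (F A)"
    using h by (rule measurable_compose)
  moreover have "h x = h (resample V A x w)" if "x \<in> space (F A)" for x
    using that w A by (intro det resample_in_space) (auto simp: space_F resample_def)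
  ultimately show ?thesis
    by (simp cong: measurable_cong)
qed

text \<open>Each generator inspects a single coordinate in \<open>A\<close>, and the property
  survives complements and countable unions. This allows indicators of \<open>F A\<close>-sets to be
  pulled out of \<open>average_off A\<close>.\<close>

lemma determined_if_sets_F:
  assumes "C \<in> sets (F A)" "x \<in> space P" "y \<in> space P" "\<And>v. v \<in> A \<Longrightarrow> x v = y v"
  shows "x \<in> C \<longleftrightarrow> y \<in> C"
  using assms(1) unfolding sets_F by induction (use assms in auto)

lemma average_off_cong:
  assumes "\<And>v. v \<in> A \<Longrightarrow> x v = x' v"
  shows "average_off A f x = average_off A f x'"
proof -
  have "resample V A x = resample V A x'"
    using assms by (auto simp: resample_def fun_eq_iff)
  then show ?thesis
    by (simp add: average_off_def)
qed

lemma average_off_determined: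
  assumes "\<And>x y. x \<in> space P \<Longrightarrow> y \<in> space P \<Longrightarrow> (\<And>v. v \<in> B \<Longrightarrow> x v = y v) \<Longrightarrow> f x = f y"
    and "x \<in> space P" "x' \<in> space P" "\<And>v. v \<in> A \<inter> B \<Longrightarrow> x v = x' v"
  shows "average_off A f x = average_off A f x'"
  unfolding average_off_def
proof (rule Bochner_Integration.integral_cong[OF refl])
  fix y assume y: "y \<in> space P"
  show "f (resample V A x y) = f (resample V A x' y)"
  proof (rule assms(1)[OF resample_in_space[OF assms(2) y] resample_in_space[OF assms(3) y]])
    show "resample V A x y v = resample V A x' y v" if "v \<in> B" for v
      using that assms(4)[of v] by (simp add: resample_def)
  qed
qed

lemma measurable_F_average_off:
  assumes [measurable]: "f \<in> borel_measurable P" and "A \<subseteq> V"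
  shows "average_off A f \<in> borel_measurable (F A)"
proof (rule measurable_F_if_determined[OF _ _ \<open>A \<subseteq> V\<close>])
qed (use assms in \<open>auto intro: average_off_cong\<close>)

text \<open>The defining property of conditional expectation is checked on each \<open>C\<close> in
  \<open>F A\<close>: resampling off \<open>A\<close> does not affect membership in
  \<open>C\<close>, so the indicator leaves the average, and averaging preserves integrals by
  \<open>distr_resample\<close>.\<close>

lemma cond_exp_eq_average_off:
  assumes f: "integrable P f" and "A \<subseteq> V"
  shows "AE x in P. real_cond_exp P (F A) f x = average_off A f x"
proof -
  interpret sigma_finite_subalgebra P "F A"
    by (rule sigma_finite_subalgebra_F[OF \<open>A \<subseteq> V\<close>])
  show ?thesis
  proof (rule real_cond_exp_charact[OF _ f integrable_average_off[OF f] measurable_F_average_off])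
    fix C assume C: "C \<in> sets (F A)"
    then have CP: "C \<in> sets P"
      using subalg by (auto simp: subalgebra_def)
    have "average_off A (\<lambda>x. indicator C x * f x) x = indicator C x * average_off A f x"
      if x: "x \<in> space P" for x
    proof -
      have "resample V A x y v = x v" if "v \<in> A" for y v
        using that \<open>A \<subseteq> V\<close> by (auto simp: resample_def)
      then have "indicator C (resample V A x y) = (indicator C x :: real)" if "y \<in> space P" for y
        using determined_if_sets_F[OF C resample_in_space[OF x that, of A] x]
        by (simp add: indicator_def)
      then have "average_off A (\<lambda>x. indicator C x * f x) x
          = (\<integral>y. indicator C x * f (resample V A x y) \<partial>P)"
        unfolding average_off_def by (intro Bochner_Integration.integral_cong) auto
      then show ?thesis
        by (simp add: average_off_def)
    qed
    then have "(\<integral>x. indicator C x * average_off A f x \<partial>P)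
        = (\<integral>x. average_off A (\<lambda>x. indicator C x * f x) x \<partial>P)"
      by (intro Bochner_Integration.integral_cong) auto
    also have "\<dots> = (\<integral>x. indicator C x * f x \<partial>P)"
      using integrable_mult_indicator[OF CP f] by (intro integral_average_off) simp
    finally show "(\<integral>x\<in>C. f x \<partial>P) = (\<integral>x\<in>C. average_off A f x \<partial>P)"
      by (simp add: set_lebesgue_integral_def)
  qed (use f \<open>A \<subseteq> V\<close> in auto)
qed

text \<open>The left side agrees almost everywhere with an iterated average that is measurable for
  \<open>F (A \<inter> B)\<close>, so conditioning on \<open>F (A \<inter> B)\<close> fixes it. Two
  uses of the tower property show that this conditioning also turns it into the right side.\<close>

lemma cond_exp_cond_exp:
  assumes f: "integrable P f" and A: "A \<subseteq> V" and B: "B \<subseteq> V"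
  shows "AE x in P. real_cond_exp P (F A) (real_cond_exp P (F B) f) x = real_cond_exp P (F (A \<inter> B)) f x"
proof -
  interpret A: sigma_finite_subalgebra P "F A"
    by (rule sigma_finite_subalgebra_F[OF A])
  interpret B: sigma_finite_subalgebra P "F B"
    by (rule sigma_finite_subalgebra_F[OF B])
  have AB: "A \<inter> B \<subseteq> V"
    using A by auto
  interpret AB: sigma_finite_subalgebra P "F (A \<inter> B)"
    by (rule sigma_finite_subalgebra_F[OF AB])
  let ?g = "real_cond_exp P (F B) f" and ?h = "average_off A (average_off B f)"
  have [measurable]: "f \<in> borel_measurable P"
    using f by auto
  have g: "integrable P ?g"
    using f by (rule B.real_cond_exp_int)
  have h: "integrable P ?h"
    by (intro integrable_average_off f)
  have "AE x in P. real_cond_exp P (F A) ?g x = real_cond_exp P (F A) (average_off B f) x"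
    using g by (intro A.real_cond_exp_cong cond_exp_eq_average_off f B) auto
  moreover have "AE x in P. real_cond_exp P (F A) (average_off B f) x = ?h x"
    by (intro cond_exp_eq_average_off integrable_average_off f A)
  ultimately have eq: "AE x in P. real_cond_exp P (F A) ?g x = ?h x"
    by auto
  \<comment> \<open>The inner average depends only on the coordinates in \<open>B\<close>;
    resampling those off \<open>A\<close> leaves a dependence on \<open>A \<inter> B\<close>
    alone.\<close>
  have meas: "?h \<in> borel_measurable (F (A \<inter> B))"
  proof (rule measurable_F_if_determined[OF _ _ AB])
    show "?h x = ?h y" if "x \<in> space P" "y \<in> space P" "\<And>v. v \<in> A \<inter> B \<Longrightarrow> x v = y v" for x y
      by (rule average_off_determined[OF average_off_cong that])
  qed simp
  have "AE x in P. real_cond_exp P (F (A \<inter> B)) ?h x = ?h x"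
    using h meas by (rule AB.real_cond_exp_F_meas)
  moreover have "AE x in P. real_cond_exp P (F (A \<inter> B)) (real_cond_exp P (F A) ?g) x
      = real_cond_exp P (F (A \<inter> B)) ?h x"
    using eq h A.real_cond_exp_int(1)[OF g] by (intro AB.real_cond_exp_cong) auto
  moreover have "AE x in P. real_cond_exp P (F (A \<inter> B)) (real_cond_exp P (F A) ?g) x
      = real_cond_exp P (F (A \<inter> B)) ?g x"
    by (intro AB.real_cond_exp_nested_subalg subalgebra_F A subalgebra_F_mono g) auto
  moreover have "AE x in P. real_cond_exp P (F (A \<inter> B)) ?g x = real_cond_exp P (F (A \<inter> B)) f x"
    by (intro AB.real_cond_exp_nested_subalg subalgebra_F B subalgebra_F_mono f) auto
  ultimately show ?thesis
    using eq by auto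
qed

section \<open>Energy of the projections\<close>

lemma integrable_mult_if_square_integrable:
  assumes "square_integrable P f" "square_integrable P g"
  shows "integrable P (\<lambda>x. f x * g x)"
proof (rule Bochner_Integration.integrable_bound)
  show "integrable P (\<lambda>x. (f x)\<^sup>2 + (g x)\<^sup>2)"
    using assms by (simp add: square_integrable_def)
  have "\<bar>a * b\<bar> \<le> a\<^sup>2 + b\<^sup>2" for a b :: real
  proof -
    have "2 * \<bar>a * b\<bar> \<le> a\<^sup>2 + b\<^sup>2"
      using sum_squares_bound[of "\<bar>a\<bar>" "\<bar>b\<bar>"] by (simp add: abs_mult mult.assoc)
    then show ?thesis
      by (smt (verit) abs_ge_zero)
  qed
  then show "AE x in P. norm (f x * g x) \<le> norm ((f x)\<^sup>2 + (g x)\<^sup>2)"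
    by simp
qed (use assms in \<open>auto simp: square_integrable_def\<close>)

lemma integrable_if_square_integrable: "square_integrable P f \<Longrightarrow> integrable P f"
  unfolding square_integrable_def by (blast intro: P.square_integrable_imp_integrable)

lemma square_integrable_diff:
  assumes "square_integrable P f" "square_integrable P g"
  shows "square_integrable P (\<lambda>x. f x - g x)"
  using assms integrable_mult_if_square_integrable[OF assms]
  by (auto simp: square_integrable_def power2_diff mult.assoc)

text \<open>This is the quantity \<open>Q A\<close> of the opening sketch.\<close>

definition energy :: "(('v \<Rightarrow> 'a) \<Rightarrow> real) \<Rightarrow> 'v set \<Rightarrow> real" where
  "energy f A = (\<integral>x. (real_cond_exp P (F A) f x)\<^sup>2 \<partial>P)"

text \<open>Conditional Jensen for the square gives a pointwise bound, which yields both
  integrability and, after integration, the contraction.\<close>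

lemma cond_exp_contraction:
  assumes f: "square_integrable P f" and "A \<subseteq> V"
  shows square_integrable_cond_exp: "square_integrable P (real_cond_exp P (F A) f)"
    and energy_le: "energy f A \<le> (\<integral>x. (f x)\<^sup>2 \<partial>P)"
proof -
  interpret sigma_finite_subalgebra P "F A"
    by (rule sigma_finite_subalgebra_F[OF \<open>A \<subseteq> V\<close>])
  have f1: "integrable P f" and f2: "integrable P (\<lambda>x. (f x)\<^sup>2)"
    using f by (auto simp: square_integrable_def intro: integrable_if_square_integrable)
  have jensen: "AE x in P. (real_cond_exp P (F A) f x)\<^sup>2 \<le> real_cond_exp P (F A) (\<lambda>x. (f x)\<^sup>2) x"
    using f1 f2 convex_power2 by (intro real_cond_exp_jensens_inequality(2)[where I = UNIV]) auto
  have e2: "integrable P (\<lambda>x. (real_cond_exp P (F A) f x)\<^sup>2)"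
  proof (rule Bochner_Integration.integrable_bound[OF real_cond_exp_int(1)[OF f2]])
    show "AE x in P. norm ((real_cond_exp P (F A) f x)\<^sup>2) \<le> norm (real_cond_exp P (F A) (\<lambda>x. (f x)\<^sup>2) x)"
      using jensen by eventually_elim (simp add: order_trans[OF _ abs_ge_self])
  qed simp
  then show "square_integrable P (real_cond_exp P (F A) f)"
    by (simp add: square_integrable_def)
  have "energy f A \<le> (\<integral>x. real_cond_exp P (F A) (\<lambda>x. (f x)\<^sup>2) x \<partial>P)"
    unfolding energy_def by (rule integral_mono_AE[OF e2 real_cond_exp_int(1)[OF f2] jensen])
  then show "energy f A \<le> (\<integral>x. (f x)\<^sup>2 \<partial>P)"
    by (simp add: real_cond_exp_int(2)[OF f2])
qed

text \<open>Pythagoras: conditioning on \<open>F A\<close> projects \<open>?b\<close> orthogonally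
  to \<open>?a\<close>, so the inner product of the two equals the squared norm of
  \<open>?a\<close>.\<close>

lemma energy_diff:
  assumes f: "square_integrable P f" and "A \<subseteq> B" "B \<subseteq> V"
  shows "energy f B - energy f A
    = (\<integral>x. (real_cond_exp P (F B) f x - real_cond_exp P (F A) f x)\<^sup>2 \<partial>P)"
proof -
  have A: "A \<subseteq> V"
    using assms by auto
  interpret sigma_finite_subalgebra P "F A"
    by (rule sigma_finite_subalgebra_F[OF A])
  let ?a = "real_cond_exp P (F A) f" and ?b = "real_cond_exp P (F B) f"
  have a: "square_integrable P ?a" and b: "square_integrable P ?b"
    using square_integrable_cond_exp[OF f] A \<open>B \<subseteq> V\<close> by auto
  have ab: "integrable P (\<lambda>x. ?a x * ?b x)"
    by (rule integrable_mult_if_square_integrable[OF a b])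
  have "AE x in P. real_cond_exp P (F A) ?b x = ?a x"
    using cond_exp_cond_exp[OF integrable_if_square_integrable[OF f] A \<open>B \<subseteq> V\<close>] \<open>A \<subseteq> B\<close>
    by (simp add: Int_absorb2)
  then have "(\<integral>x. ?a x * real_cond_exp P (F A) ?b x \<partial>P) = (\<integral>x. ?a x * ?a x \<partial>P)"
    by (intro integral_cong_AE) auto
  moreover have "(\<integral>x. ?a x * real_cond_exp P (F A) ?b x \<partial>P) = (\<integral>x. ?a x * ?b x \<partial>P)"
    using ab by (intro real_cond_exp_intg) auto
  ultimately have "(\<integral>x. ?a x * ?b x \<partial>P) = energy f A"
    by (simp add: energy_def power2_eq_square)
  moreover have "(\<integral>x. (?b x - ?a x)\<^sup>2 \<partial>P)
      = (\<integral>x. (?b x)\<^sup>2 + (?a x)\<^sup>2 - 2 * (?a x * ?b x) \<partial>P)"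
    by (simp add: power2_diff mult_ac)
  moreover have "\<dots> = energy f B + energy f A - 2 * (\<integral>x. ?a x * ?b x \<partial>P)"
    using a b ab by (simp add: energy_def square_integrable_def)
  ultimately show ?thesis
    by simp
qed

text \<open>Conditioning on \<open>U\<close> maps the martingale increment from \<open>A\<close> to \<open>B\<close> to the one from
  \<open>U \<inter> A\<close> to \<open>U \<inter> B\<close>, and it is an \<open>L\<^sup>2\<close>-contraction.\<close>

lemma energy_diff_Int_le:
  assumes f: "square_integrable P f" and "A \<subseteq> B" "B \<subseteq> V" "U \<subseteq> V"
  shows "energy f (U \<inter> B) - energy f (U \<inter> A) \<le> energy f B - energy f A"
proof -
  have A: "A \<subseteq> V"
    using assms by auto
  interpret sigma_finite_subalgebra P "F U"
    by (rule sigma_finite_subalgebra_F[OF \<open>U \<subseteq> V\<close>])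
  let ?e = "\<lambda>A. real_cond_exp P (F A) f"
  let ?d = "\<lambda>x. ?e B x - ?e A x"
  have a: "square_integrable P (?e A)" and b: "square_integrable P (?e B)"
    using square_integrable_cond_exp[OF f] A \<open>B \<subseteq> V\<close> by auto
  have f1: "integrable P f"
    by (rule integrable_if_square_integrable[OF f])
  have "AE x in P. real_cond_exp P (F U) ?d x = real_cond_exp P (F U) (?e B) x - real_cond_exp P (F U) (?e A) x"
    using a b by (intro real_cond_exp_diff integrable_if_square_integrable)
  moreover have "AE x in P. real_cond_exp P (F U) (?e B) x = ?e (U \<inter> B) x"
    by (rule cond_exp_cond_exp[OF f1 \<open>U \<subseteq> V\<close> \<open>B \<subseteq> V\<close>])
  moreover have "AE x in P. real_cond_exp P (F U) (?e A) x = ?e (U \<inter> A) x"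
    by (rule cond_exp_cond_exp[OF f1 \<open>U \<subseteq> V\<close> A])
  ultimately have eq: "AE x in P. real_cond_exp P (F U) ?d x = ?e (U \<inter> B) x - ?e (U \<inter> A) x"
    by auto
  have [measurable]: "?e C \<in> borel_measurable P" for C
    by simp
  have "energy f (U \<inter> B) - energy f (U \<inter> A) = (\<integral>x. (?e (U \<inter> B) x - ?e (U \<inter> A) x)\<^sup>2 \<partial>P)"
    using assms by (intro energy_diff) auto
  also have "\<dots> = energy ?d U"
    unfolding energy_def using eq by (intro integral_cong_AE) auto
  also have "\<dots> \<le> (\<integral>x. (?d x)\<^sup>2 \<partial>P)"
    by (intro energy_le square_integrable_diff a b \<open>U \<subseteq> V\<close>)
  also have "\<dots> = energy f B - energy f A"
    using assms by (intro energy_diff[symmetric]) auto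
  finally show ?thesis .
qed

section \<open>The covering inequality for the energy\<close>

lemma energy_mono:
  assumes "square_integrable P f" "A \<subseteq> B" "B \<subseteq> V"
  shows "energy f A \<le> energy f B"
proof -
  have "0 \<le> energy f B - energy f A"
    unfolding energy_diff[OF assms] by simp
  then show ?thesis
    by simp
qed

lemma sum_energy_le:
  assumes f: "square_integrable P f" and "finite I"
    and S: "\<And>i. i \<in> I \<Longrightarrow> S i \<subseteq> V"
    and cover: "\<And>v. v \<in> V \<Longrightarrow> card {i \<in> I. v \<in> S i} \<le> k"
  shows "(\<Sum>i\<in>I. energy f (S i) - energy f {}) \<le> real k * (energy f V - energy f {})"
proof -
  \<comment> \<open>Generalised from \<open>V\<close> to the set \<open>W\<close> of coordinates
    revealed so far; for empty \<open>W\<close> both sides vanish.\<close>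
  have "(\<Sum>i\<in>I. energy f (S i \<inter> W) - energy f {}) \<le> real k * (energy f W - energy f {})"
    if "finite W" "W \<subseteq> V" for W
    using that
  proof (induction W)
    case (insert v W)
    let ?d = "energy f (insert v W) - energy f W"
    have d: "0 \<le> ?d"
      using energy_mono[OF f, of W "insert v W"] insert.prems by auto
    \<comment> \<open>If \<open>v\<close> lies outside \<open>S i\<close>, the two intersections
      coincide. Otherwise the increment from \<open>W\<close> to \<open>insert v W\<close> is
      contracted by conditioning on \<open>S i\<close>.\<close>
    have "energy f (S i \<inter> insert v W) - energy f (S i \<inter> W) \<le> (if v \<in> S i then ?d else 0)"
      if "i \<in> I" for i
      using energy_diff_Int_le[OF f _ insert.prems S[OF that], of W] by (auto simp: subset_insertI)
    then have "(\<Sum>i\<in>I. energy f (S i \<inter> insert v W) - energy f (S i \<inter> W))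
        \<le> (\<Sum>i\<in>I. if v \<in> S i then ?d else 0)"
      by (rule sum_mono)
    also have "\<dots> = real (card {i \<in> I. v \<in> S i}) * ?d"
      using \<open>finite I\<close> by (simp add: sum.If_cases Int_def)
    also have "\<dots> \<le> real k * ?d"
      using cover[of v] insert.prems d by (intro mult_right_mono) auto
    finally have "(\<Sum>i\<in>I. energy f (S i \<inter> insert v W) - energy f (S i \<inter> W)) \<le> real k * ?d" .
    moreover have "(\<Sum>i\<in>I. energy f (S i \<inter> W) - energy f {}) \<le> real k * (energy f W - energy f {})"
      using insert by simp
    ultimately show ?case
      by (simp add: sum_subtractf algebra_simps)
  qed simp
  from this[OF finite_V order_refl] show ?thesis
    using S by (simp add: Int_absorb2)
qed

section \<open>Extreme values of the energy and variances\<close>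

lemma energy_eq_average_off:
  assumes "integrable P f" "A \<subseteq> V"
  shows "energy f A = (\<integral>x. (average_off A f x)\<^sup>2 \<partial>P)"
  unfolding energy_def using cond_exp_eq_average_off[OF assms] assms(1)
  by (intro integral_cong_AE) auto

text \<open>Resampling every coordinate makes the average constant, equal to the mean. Subtracting
  \<open>energy f {}\<close> therefore turns an energy into a variance.\<close>

lemma energy_empty:
  assumes "integrable P f"
  shows "energy f {} = (\<integral>x. f x \<partial>P)\<^sup>2"
proof -
  have "resample V {} x y = y" if "y \<in> space P" for x y
    using that by (auto simp: resample_def space_PiM PiE_iff extensional_restrict)
  then have "average_off {} f x = (\<integral>y. f y \<partial>P)" for x
    unfolding average_off_def by (intro Bochner_Integration.integral_cong) auto
  then show ?thesis
    using energy_eq_average_off[OF assms] P.prob_space by simp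
qed

lemma energy_full:
  assumes "integrable P f"
  shows "energy f V = (\<integral>x. (f x)\<^sup>2 \<partial>P)"
proof -
  have "resample V V x y = x" if "x \<in> space P" for x y
    using that by (auto simp: resample_def space_PiM PiE_iff extensional_def fun_eq_iff)
  then have "average_off V f x = f x" if "x \<in> space P" for x
    unfolding average_off_def using that P.prob_space by simp
  then show ?thesis
    unfolding energy_eq_average_off[OF assms order_refl]
    by (intro Bochner_Integration.integral_cong) auto
qed

text \<open>Conditioning preserves the mean, so the squared mean to subtract is that of
  \<open>f\<close>, for every \<open>A\<close>.\<close>

lemma variance_cond_exp:
  assumes f: "square_integrable P f" and "A \<subseteq> V"
  shows "P.variance (real_cond_exp P (F A) f) = energy f A - energy f {}"
proof -
  interpret sigma_finite_subalgebra P "F A"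
    by (rule sigma_finite_subalgebra_F[OF \<open>A \<subseteq> V\<close>])
  have f1: "integrable P f"
    by (rule integrable_if_square_integrable[OF f])
  have e2: "integrable P (\<lambda>x. (real_cond_exp P (F A) f x)\<^sup>2)"
    using square_integrable_cond_exp[OF assms] by (simp add: square_integrable_def)
  show ?thesis
    unfolding energy_empty[OF f1] P.variance_eq[OF real_cond_exp_int(1)[OF f1] e2]
    by (simp add: real_cond_exp_int(2)[OF f1] energy_def)
qed

lemma variance_eq_energy:
  assumes f: "square_integrable P f"
  shows "P.variance f = energy f V - energy f {}"
  using f integrable_if_square_integrable[OF f]
  by (simp add: P.variance_eq energy_full energy_empty square_integrable_def)

section \<open>Permutations of the coordinates\<close>

lemma
  assumes \<gamma>: "bij_betw \<gamma> V V"
  shows measurable_permute_coords: "permute_coords V \<gamma> \<in> measurable P P"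
    and distr_permute_coords: "distr P P (permute_coords V \<gamma>) = P"
proof -
  have inv: "bij_betw (inv_into V \<gamma>) V V"
    by (rule bij_betw_inv_into[OF \<gamma>])
  then have "inv_into V \<gamma> v \<in> V" if "v \<in> V" for v
    using that by (auto simp: bij_betw_def)
  then show "permute_coords V \<gamma> \<in> measurable P P"
    unfolding permute_coords_def[abs_def] by (intro measurable_restrict) auto
  have "distr P P (\<lambda>x. \<lambda>v\<in>V. x (inv_into V \<gamma> v)) = P"
    using inv finite_V by (intro distr_reorder) (auto simp: bij_betw_def)
  then show "distr P P (permute_coords V \<gamma>) = P"
    unfolding permute_coords_def[abs_def] .
qed

text \<open>Equivariance of resampling: a site lies in the translate of \<open>A\<close> exactly
  when its preimage under \<gamma> lies in \<open>A\<close>, and the permuted configurations are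
  read at that preimage.\<close>

lemma resample_permute_coords:
  assumes \<gamma>: "bij_betw \<gamma> V V" and "A \<subseteq> V"
  shows "resample V (\<gamma> ` A) (permute_coords V \<gamma> x) (permute_coords V \<gamma> y)
    = permute_coords V \<gamma> (resample V A x y)"
proof
  fix v
  have "inv_into V \<gamma> v \<in> V" "v \<in> \<gamma> ` A \<longleftrightarrow> inv_into V \<gamma> v \<in> A" if "v \<in> V"
  proof -
    obtain w where w: "w \<in> V" "v = \<gamma> w"
      using \<gamma> \<open>v \<in> V\<close> by (auto simp: bij_betw_def)
    then have "inv_into V \<gamma> v = w"
      using \<gamma> by (auto simp: bij_betw_def)
    then show "inv_into V \<gamma> v \<in> V" "v \<in> \<gamma> ` A \<longleftrightarrow> inv_into V \<gamma> v \<in> A"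
      using w \<gamma> \<open>A \<subseteq> V\<close> by (auto simp: bij_betw_def dest: inj_onD)
  qed
  then show "resample V (\<gamma> ` A) (permute_coords V \<gamma> x) (permute_coords V \<gamma> y) v
      = permute_coords V \<gamma> (resample V A x y) v"
    by (simp add: resample_def permute_coords_def)
qed

text \<open>The permutation preserves \<open>P\<close>, so substituting permuted configurations for
  both arguments carries averages off the translate of \<open>A\<close> to averages off
  \<open>A\<close>; invariance of \<open>f\<close> then removes the permutation.\<close>

lemma energy_image:
  assumes f: "integrable P f" and \<gamma>: "bij_betw \<gamma> V V" and "A \<subseteq> V"
    and inv: "AE x in P. f (permute_coords V \<gamma> x) = f x"
  shows "energy f (\<gamma> ` A) = energy f A"
proof -
  note [measurable] = measurable_permute_coords[OF \<gamma>]
  have [measurable]: "f \<in> borel_measurable P"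
    using f by auto
  have [measurable]: "(\<lambda>y. resample V B x y) \<in> measurable P P" if "x \<in> space P" for B x
    using measurable_Pair2[OF measurable_resample that, of B] by simp
  have "\<gamma> ` A \<subseteq> V"
    using \<gamma> \<open>A \<subseteq> V\<close> by (auto simp: bij_betw_def)
  \<comment> \<open>Invariance holds only almost everywhere, so the exceptional null set is first
    pulled back along the resampling map, whose law is \<open>P\<close>, and then sliced by
    Fubini.\<close>
  have "AE z in P \<Otimes>\<^sub>M P. f (permute_coords V \<gamma> (case z of (x, y) \<Rightarrow> resample V A x y))
      = f (case z of (x, y) \<Rightarrow> resample V A x y)"
    using inv by (intro AE_distrD[OF measurable_resample]) (simp only: distr_resample)
  then have "AE x in P. AE y in P. f (permute_coords V \<gamma> (resample V A x y)) = f (resample V A x y)"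
    using PP.AE_pair by fastforce
  then have "AE x in P. average_off (\<gamma> ` A) f (permute_coords V \<gamma> x) = average_off A f x"
    using AE_space
  proof eventually_elim
    case (elim x)
    have x: "permute_coords V \<gamma> x \<in> space P"
      using elim(2) by (rule measurable_space[OF measurable_permute_coords[OF \<gamma>]])
    have "average_off (\<gamma> ` A) f (permute_coords V \<gamma> x)
        = (\<integral>y. f (resample V (\<gamma> ` A) (permute_coords V \<gamma> x) y) \<partial>distr P P (permute_coords V \<gamma>))"
      by (simp add: average_off_def distr_permute_coords[OF \<gamma>])
    also have "\<dots> = (\<integral>y. f (resample V (\<gamma> ` A) (permute_coords V \<gamma> x) (permute_coords V \<gamma> y)) \<partial>P)"
      using x by (intro integral_distr) auto
    also have "\<dots> = (\<integral>y. f (permute_coords V \<gamma> (resample V A x y)) \<partial>P)"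
      by (simp add: resample_permute_coords[OF \<gamma> \<open>A \<subseteq> V\<close>])
    also have "\<dots> = average_off A f x"
      unfolding average_off_def using elim by (intro integral_cong_AE) auto
    finally show ?case .
  qed
  then have "(\<integral>x. (average_off (\<gamma> ` A) f (permute_coords V \<gamma> x))\<^sup>2 \<partial>P) = energy f A"
    unfolding energy_eq_average_off[OF f \<open>A \<subseteq> V\<close>] by (intro integral_cong_AE) auto
  moreover have "(\<integral>x. (average_off (\<gamma> ` A) f (permute_coords V \<gamma> x))\<^sup>2 \<partial>P)
      = (\<integral>x. (average_off (\<gamma> ` A) f x)\<^sup>2 \<partial>distr P P (permute_coords V \<gamma>))"
    by (intro integral_distr[symmetric]) auto
  ultimately show ?thesis
    by (simp add: distr_permute_coords[OF \<gamma>] energy_eq_average_off[OF f \<open>\<gamma> ` A \<subseteq> V\<close>])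
qed

end

section \<open>Counting in transitive permutation groups\<close>

lemma transitive_perm_groupD:
  assumes "transitive_perm_group V \<Gamma>"
  shows "\<Gamma> \<subseteq> Bij V"
    and "\<Gamma> \<noteq> {}"
    and "\<gamma> \<in> \<Gamma> \<Longrightarrow> \<delta> \<in> \<Gamma> \<Longrightarrow> compose V \<gamma> \<delta> \<in> \<Gamma>"
    and "x \<in> V \<Longrightarrow> y \<in> V \<Longrightarrow> \<exists>\<gamma>\<in>\<Gamma>. \<gamma> x = y"
proof -
  have sub: "subgroup \<Gamma> (BijGroup V)"
    and trans: "transitive_action ((BijGroup V)\<lparr>carrier := \<Gamma>\<rparr>) V (\<lambda>\<gamma>. \<gamma>)"
    using assms by (auto simp: transitive_perm_group_def)
  show Bij: "\<Gamma> \<subseteq> Bij V"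
    using subgroup.subset[OF sub] by (simp add: BijGroup_def)
  show "\<Gamma> \<noteq> {}"
    using subgroup.one_closed[OF sub] by auto
  show "compose V \<gamma> \<delta> \<in> \<Gamma>" if "\<gamma> \<in> \<Gamma>" "\<delta> \<in> \<Gamma>"
    using subgroup.m_closed[OF sub that] Bij[THEN subsetD, OF that(1)] Bij[THEN subsetD, OF that(2)]
    by (simp add: BijGroup_def)
  show "\<exists>\<gamma>\<in>\<Gamma>. \<gamma> x = y" if "x \<in> V" "y \<in> V"
    using transitive_action.unique_orbit[OF trans that] by simp
qed

lemma finite_transitive_perm_group:
  assumes "transitive_perm_group V \<Gamma>" "finite V"
  shows "finite \<Gamma>"
proof (rule finite_subset)
  show "\<Gamma> \<subseteq> V \<rightarrow>\<^sub>E V"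
    using transitive_perm_groupD(1)[OF assms(1)] by (auto simp: Bij_def PiE_def bij_betw_def)
  show "finite (V \<rightarrow>\<^sub>E V)"
    using assms(2) by (simp add: finite_PiE)
qed

text \<open>Composition with a group element sending \<open>w\<close> to \<open>w'\<close> injects
  the transporter from \<open>u\<close> to \<open>w\<close> into the one from \<open>u\<close> to
  \<open>w'\<close>. Hence all \<open>card V\<close> transporters out of \<open>u\<close> have equal
  size, and they partition \<Gamma>.\<close>

lemma card_transporter:
  assumes \<Gamma>: "transitive_perm_group V \<Gamma>" and "finite V" "u \<in> V" "v \<in> V"
  shows "card V * card {\<gamma> \<in> \<Gamma>. \<gamma> u = v} = card \<Gamma>"
proof -
  note D = transitive_perm_groupD[OF \<Gamma>]
  have fin: "finite \<Gamma>"
    using finite_transitive_perm_group[OF \<Gamma> \<open>finite V\<close>] .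
  have le: "card {\<gamma> \<in> \<Gamma>. \<gamma> u = w} \<le> card {\<gamma> \<in> \<Gamma>. \<gamma> u = w'}" if "w \<in> V" "w' \<in> V" for w w'
  proof -
    obtain \<delta> where \<delta>: "\<delta> \<in> \<Gamma>" "\<delta> w = w'"
      using D(4)[OF \<open>w \<in> V\<close> \<open>w' \<in> V\<close>] by blast
    have inj: "inj_on \<delta> V"
      using \<delta>(1) D(1) by (auto simp: Bij_def bij_betw_def)
    show ?thesis
    proof (rule card_inj_on_le)
      show "inj_on (compose V \<delta>) {\<gamma> \<in> \<Gamma>. \<gamma> u = w}"
      proof (rule inj_onI)
        fix \<gamma> \<gamma>' assume *: "\<gamma> \<in> {\<gamma> \<in> \<Gamma>. \<gamma> u = w}" "\<gamma>' \<in> {\<gamma> \<in> \<Gamma>. \<gamma> u = w}"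
          "compose V \<delta> \<gamma> = compose V \<delta> \<gamma>'"
        then have B: "\<gamma> \<in> Bij V" "\<gamma>' \<in> Bij V"
          using D(1) by auto
        show "\<gamma> = \<gamma>'"
        proof (rule extensionalityI[OF Bij_imp_extensional[OF B(1)] Bij_imp_extensional[OF B(2)]])
          fix x assume x: "x \<in> V"
          have "\<delta> (\<gamma> x) = \<delta> (\<gamma>' x)"
            using fun_cong[OF *(3), of x] x by (simp add: compose_eq)
          moreover have "\<gamma> x \<in> V" "\<gamma>' x \<in> V"
            using B[THEN Bij_imp_funcset] x by auto
          ultimately show "\<gamma> x = \<gamma>' x"
            using inj by (auto dest: inj_onD)
        qed
      qed
      show "compose V \<delta> ` {\<gamma> \<in> \<Gamma>. \<gamma> u = w} \<subseteq> {\<gamma> \<in> \<Gamma>. \<gamma> u = w'}"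
        using \<delta> D(3) \<open>u \<in> V\<close> by (auto simp: compose_eq)
    qed (use fin in auto)
  qed
  have "\<gamma> u \<in> V" if "\<gamma> \<in> \<Gamma>" for \<gamma>
    using Bij_imp_funcset[OF subsetD[OF D(1) that]] \<open>u \<in> V\<close> by auto
  then have "card \<Gamma> = card (\<Union>w\<in>V. {\<gamma> \<in> \<Gamma>. \<gamma> u = w})"
    by (intro arg_cong[of _ _ card]) auto
  also have "\<dots> = (\<Sum>w\<in>V. card {\<gamma> \<in> \<Gamma>. \<gamma> u = w})"
    using fin \<open>finite V\<close> by (intro card_UN_disjoint) auto
  also have "\<dots> = (\<Sum>w\<in>V. card {\<gamma> \<in> \<Gamma>. \<gamma> u = v})"
    using le \<open>v \<in> V\<close> by (intro sum.cong refl antisym) auto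
  finally show ?thesis
    by simp
qed

text \<open>By injectivity, a translate of \<open>U\<close> covers \<open>v\<close> through exactly
  one \<open>u\<close> in \<open>U\<close>, so the transporters from the points of \<open>U\<close>
  to \<open>v\<close> add up. The product form avoids division of natural numbers.\<close>

lemma card_covering_translates:
  assumes \<Gamma>: "transitive_perm_group V \<Gamma>" and "finite V" "U \<subseteq> V" "v \<in> V"
  shows "card V * card {\<gamma> \<in> \<Gamma>. v \<in> \<gamma> ` U} = card \<Gamma> * card U"
proof -
  have inj: "\<gamma> u = \<gamma> u' \<Longrightarrow> u = u'" if "\<gamma> \<in> \<Gamma>" "u \<in> V" "u' \<in> V" for \<gamma> u u'
    using transitive_perm_groupD(1)[OF \<Gamma>] that by (auto simp: Bij_def bij_betw_def dest: inj_onD)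
  have "card {\<gamma> \<in> \<Gamma>. v \<in> \<gamma> ` U} = card (\<Union>u\<in>U. {\<gamma> \<in> \<Gamma>. \<gamma> u = v})"
    by (intro arg_cong[of _ _ card]) auto
  also have "\<dots> = (\<Sum>u\<in>U. card {\<gamma> \<in> \<Gamma>. \<gamma> u = v})"
  proof (rule card_UN_disjoint)
    show "finite U"
      using assms finite_subset by auto
    show "\<forall>u\<in>U. finite {\<gamma> \<in> \<Gamma>. \<gamma> u = v}"
      using finite_transitive_perm_group[OF \<Gamma> \<open>finite V\<close>] by auto
    show "\<forall>u\<in>U. \<forall>u'\<in>U. u \<noteq> u' \<longrightarrow> {\<gamma> \<in> \<Gamma>. \<gamma> u = v} \<inter> {\<gamma> \<in> \<Gamma>. \<gamma> u' = v} = {}"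
      using inj \<open>U \<subseteq> V\<close> by blast
  qed
  finally have "card V * card {\<gamma> \<in> \<Gamma>. v \<in> \<gamma> ` U} = (\<Sum>u\<in>U. card V * card {\<gamma> \<in> \<Gamma>. \<gamma> u = v})"
    by (simp add: sum_distrib_left)
  also have "\<dots> = (\<Sum>u\<in>U. card \<Gamma>)"
    using card_transporter[OF \<Gamma> \<open>finite V\<close> _ \<open>v \<in> V\<close>] \<open>U \<subseteq> V\<close> by (intro sum.cong) auto
  finally show ?thesis
    by simp
qed

section \<open>The clue of a transitive function\<close>

text \<open>The covering inequality is applied to the family of all translates of \<open>U\<close>,
  indexed by \<Gamma>. All of them have the energy of \<open>U\<close>, so the sum is
  \<open>card \<Gamma>\<close> times a single term.\<close>

lemma clue_le:
  assumes "finite V" "V \<noteq> {}" "prob_space M"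
    and f: "square_integrable (iid_space V M) f"
    and var: "prob_space.variance (iid_space V M) f > 0"
    and \<Gamma>: "transitive_perm_group V \<Gamma>" and inv: "perm_invariant V M \<Gamma> f"
    and U: "U \<subseteq> V"
  shows "clue V M f U \<le> real (card U) / real (card V)"
proof -
  interpret iid_product V M
    using assms by (intro iid_product.intro)
  note D = transitive_perm_groupD[OF \<Gamma>]
  have fin: "finite \<Gamma>"
    using finite_transitive_perm_group[OF \<Gamma> \<open>finite V\<close>] .
  have pos: "0 < card \<Gamma>" "0 < card V"
    using fin D(2) \<open>finite V\<close> \<open>V \<noteq> {}\<close> by (auto simp: card_gt_0_iff)
  have bij: "bij_betw \<gamma> V V" if "\<gamma> \<in> \<Gamma>" for \<gamma>
    using D(1) that by (auto simp: Bij_def)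
  obtain v where v: "v \<in> V"
    using \<open>V \<noteq> {}\<close> by blast
  \<comment> \<open>The covering multiplicity at an arbitrary site \<open>v\<close>; the double
    count shows that every other site has the same one.\<close>
  define k where "k = card {\<gamma> \<in> \<Gamma>. v \<in> \<gamma> ` U}"
  have k: "card V * k = card \<Gamma> * card U"
    unfolding k_def by (rule card_covering_translates[OF \<Gamma> \<open>finite V\<close> U v])
  have eq: "energy f (\<gamma> ` U) = energy f U" if "\<gamma> \<in> \<Gamma>" for \<gamma>
    using inv that
    by (intro energy_image integrable_if_square_integrable f bij U) (auto simp: perm_invariant_def)
  have "(\<Sum>\<gamma>\<in>\<Gamma>. energy f (\<gamma> ` U) - energy f {}) \<le> real k * (energy f V - energy f {})"
  proof (rule sum_energy_le[OF f fin])
    show "\<gamma> ` U \<subseteq> V" if "\<gamma> \<in> \<Gamma>" for \<gamma>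
      using bij[OF that] U by (auto simp: bij_betw_def)
    show "card {\<gamma> \<in> \<Gamma>. w \<in> \<gamma> ` U} \<le> k" if "w \<in> V" for w
    proof -
      have "card V * card {\<gamma> \<in> \<Gamma>. w \<in> \<gamma> ` U} = card V * k"
        unfolding k by (rule card_covering_translates[OF \<Gamma> \<open>finite V\<close> U that])
      then show ?thesis
        using pos by simp
    qed
  qed
  \<comment> \<open>Multiplying by \<open>card V\<close> makes the product \<open>card V * k\<close>
    appear, which the double count replaces by \<open>card \<Gamma> * card U\<close>; the factor
    \<open>card \<Gamma>\<close> then cancels.\<close>
  then have "real (card V) * (real (card \<Gamma>) * (energy f U - energy f {}))
      \<le> real (card V) * (real k * (energy f V - energy f {}))"
    using eq by (intro mult_left_mono) auto
  also have "\<dots> = real (card V * k) * (energy f V - energy f {})"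
    by simp
  also have "\<dots> = real (card \<Gamma>) * (real (card U) * (energy f V - energy f {}))"
    unfolding k by simp
  finally have "real (card \<Gamma>) * (real (card V) * (energy f U - energy f {}))
      \<le> real (card \<Gamma>) * (real (card U) * (energy f V - energy f {}))"
    by (simp add: mult_ac)
  then have "real (card V) * (energy f U - energy f {}) \<le> real (card U) * (energy f V - energy f {})"
    using pos by simp
  moreover have "0 < energy f V - energy f {}"
    using var unfolding variance_eq_energy[OF f] .
  ultimately show ?thesis
    unfolding clue_def variance_eq_energy[OF f] variance_cond_exp[OF f U]
    using pos by (simp add: field_simps)
qed

text \<open>The product over no coordinates is a single point, so every function on it is constant.
  Positive variance thus forces a non-empty site set, as \<open>clue_le\<close> requires.\<close>

lemma variance_iid_space_empty:
  fixes f :: "('v \<Rightarrow> 'a) \<Rightarrow> real"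
  shows "prob_space.variance (iid_space {} M) f = 0"
proof -
  interpret prob_space "iid_space {} M :: ('v \<Rightarrow> 'a) measure"
    by (rule prob_space_PiM) simp
  have "expectation (\<lambda>x. f x) = f (\<lambda>_. undefined)"
  proof -
    have "expectation (\<lambda>x. f x) = expectation (\<lambda>x. f (\<lambda>_. undefined))"
      by (intro Bochner_Integration.integral_cong) (auto simp: space_PiM)
    then show ?thesis
      by (simp add: prob_space)
  qed
  then have "variance f = expectation (\<lambda>x. 0)"
    by (intro Bochner_Integration.integral_cong) (auto simp: space_PiM)
  then show ?thesis
    by simp
qed

lemma not_sparse_reconstruction:
  assumes fin: "\<And>n. finite (V n)" and prob: "\<And>n. prob_space (M n)"
    and f: "\<And>n. square_integrable (iid_space (V n) (M n)) (f n)"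
    and var: "\<And>n. prob_space.variance (iid_space (V n) (M n)) (f n) > 0"
    and inv: "\<And>n. \<exists>\<Gamma>. transitive_perm_group (V n) \<Gamma> \<and> perm_invariant (V n) (M n) \<Gamma> (f n)"
  shows "\<not> sparse_reconstruction V M f"
proof
  assume "sparse_reconstruction V M f"
  then obtain U where U: "\<And>n. U n \<subseteq> V n"
    and lim: "(\<lambda>n. real (card (U n)) / real (card (V n))) \<longlonglongrightarrow> 0"
    and liminf: "liminf (\<lambda>n. ereal (clue (V n) (M n) (f n) (U n))) > 0"
    unfolding sparse_reconstruction_def by blast
  have "clue (V n) (M n) (f n) (U n) \<le> real (card (U n)) / real (card (V n))" for n
  proof -
    have "V n \<noteq> {}"
      using var[of n] variance_iid_space_empty[of "M n" "f n"] by (cases "V n = {}") simp_all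
    then show ?thesis
      using inv[of n] clue_le[OF fin _ prob f var _ _ U] by blast
  qed
  \<comment> \<open>The density bound passes to the lower limits, and the densities tend to 0,
    contradicting the positive lower limit of the clues.\<close>
  then have "liminf (\<lambda>n. ereal (clue (V n) (M n) (f n) (U n)))
      \<le> liminf (\<lambda>n. ereal (real (card (U n)) / real (card (V n))))"
    by (intro Liminf_mono always_eventually) simp
  also have "\<dots> = 0"
    using lim_imp_Liminf[OF sequentially_bot tendsto_ereal[OF lim]] by (simp add: zero_ereal_def)
  finally show False
    using liminf by simp
qed

theorem theorem1p1:
  shows "(\<forall>(V :: 'v set) (M :: 'a measure) (f :: ('v \<Rightarrow> 'a) \<Rightarrow> real) \<Gamma>.
            finite V \<longrightarrow> V \<noteq> {} \<longrightarrow> prob_space M \<longrightarrow>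
            square_integrable (iid_space V M) f \<longrightarrow>
            prob_space.variance (iid_space V M) f > 0 \<longrightarrow>
            transitive_perm_group V \<Gamma> \<longrightarrow> perm_invariant V M \<Gamma> f \<longrightarrow>
            (\<forall>U. U \<subseteq> V \<longrightarrow> clue V M f U \<le> real (card U) / real (card V)))
       \<and> (\<forall>(V :: nat \<Rightarrow> 'w set) (M :: nat \<Rightarrow> 'b measure) (f :: nat \<Rightarrow> ('w \<Rightarrow> 'b) \<Rightarrow> real).
            (\<forall>n. finite (V n) \<and> prob_space (M n) \<and>
                 square_integrable (iid_space (V n) (M n)) (f n) \<and>
                 prob_space.variance (iid_space (V n) (M n)) (f n) > 0 \<and>
                 (\<exists>\<Gamma>. transitive_perm_group (V n) \<Gamma> \<and> perm_invariant (V n) (M n) \<Gamma> (f n)))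
            \<longrightarrow> \<not> sparse_reconstruction V M f)"
proof (intro conjI allI impI)
  show "clue V M f U \<le> real (card U) / real (card V)"
    if "finite V" "V \<noteq> {}" "prob_space M" "square_integrable (iid_space V M) f"
      "prob_space.variance (iid_space V M) f > 0" "transitive_perm_group V \<Gamma>"
      "perm_invariant V M \<Gamma> f" "U \<subseteq> V"
    for V :: "'v set" and M :: "'a measure" and f :: "('v \<Rightarrow> 'a) \<Rightarrow> real" and \<Gamma> U
    using that by (rule clue_le)
qed (rule not_sparse_reconstruction, blast+)

end
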